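(* Let $n \geqslant 1$. Then for $1 \leqslant \ell, k \leqslant n+1$ and $(a,b)\in[1]\times[n]$ we have: $$|L(n,k,\ell,(0,0))| = \sum_{k-1 \leqslant k' \leqslant n} |L(n-1,k',\ell-1)|,$$ $$|L(n,k,\ell,(1,n))| = \sum_{\ell-1 \leqslant \ell' \leqslant n} |L(n-1,k-1,\ell')|,$$ $$|L(n,k,\ell,(0,b))| = \sum_{0 \leqslant i \leqslant k} |\mathrm{Tam}(b-1,i)| \cdot |L(n-b,k-i,\ell,(0,0))| \qquad (0<b\leqslant n),$$ $$|L(n,k,\ell,(1,b))| = 0 \qquad (0\leqslant b<n).$$ Moreover, for every $n\geqslant 0$, $$|L(n)| = \sum_{\substack{1 \leqslant k, \ell \leqslant n+1 \\ (a,b) \in [1] \times [n]}} |L(n,k,\ell,(a,b))|.$$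
   Context: $[n]=\{0<1<\cdots<n\}$ and $[1]\times[n]$ has the product order; it is a lattice with maximum $(1,n)$. A transfer system on a lattice is a partial order $\mathcal{R}$ on its underlying set such that $x\,\mathcal{R}\,y$ implies $x\leqslant y$, and whenever $x\,\mathcal{R}\,y$ and $z\leqslant y$ we have $(x\wedge z)\,\mathcal{R}\,z$. A transfer system $\mathcal{R}$ on $[1]\times[n]$ is liftable if whenever $(1,i)\,\mathcal{R}\,(1,j)$ for some $i<j$, then $(0,i)\,\mathcal{R}\,(1,i)$. $L(n)$ is the set of liftable transfer systems on $[1]\times[n]$. For a transfer system $\mathcal{R}$ on $[1]\times[n]$: an element $(1,b)$ is stationary if there are no $c,d$ with $d>b\geqslant c$ and $(1,c)\,\mathcal{R}\,(1,d)$; an element $(0,b)$ is extendable if $(0,b)\,\mathcal{R}\,(0,n)$ (elements $(0,b)$ are never stationary and elements $(1,b)$ are never extendable). An element $x$ is fibrant if $x\,\mathcal{R}\,(1,n)$; there is a unique minimal fibrant element. $L(n,k)$ is the set of $\mathcal{R}\in L(n)$ with exactly $k$ stationary elements; $L(n,k,\ell)$ is the set of $\mathcal{R}\in L(n,k)$ with exactly $\ell$ extendable elements; $L(n,k,\ell,(a,b))$ is the set of $\mathcal{R}\in L(n,k,\ell)$ whose minimal fibrant element is $(a,b)$. By convention these have cardinality $0$ when $k$ or $\ell$ is out of the range $1,\dots,n+1$. $\mathrm{Tam}(n)\subset L(n)$ is the set of all transfer systems $\mathcal{R}$ on $[1]\times[n]$ with $(0,n)\,\mathcal{R}\,(1,n)$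 and $\mathrm{Tam}(n,k)=\mathrm{Tam}(n)\cap L(n,k)$. *)

theory Defs
  imports Main "HOL-Library.Product_Order"
begin

text \<open>The order and meet on pairs are the componentwise ones of \<^theory>\<open>HOL-Library.Product_Order\<close>.
  The lattice under consideration is a subset \<open>X\<close> of an ambient lattice type that is closed
  under \<^const>\<open>inf\<close>; \<^const>\<open>partial_order_on\<close> includes \<open>R \<subseteq> X \<times> X\<close>.\<close>

definition transfer_system_on :: "'a::lattice set \<Rightarrow> 'a rel \<Rightarrow> bool" where
  "transfer_system_on X R \<longleftrightarrow>
     partial_order_on X R \<and>
     (\<forall>x y. (x, y) \<in> R \<longrightarrow> x \<le> y) \<and>
     (\<forall>x y z. (x, y) \<in> R \<and> z \<in> X \<and> z \<le> y \<longrightarrow> (inf x z, z) \<in> R)"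

definition grid :: "nat \<Rightarrow> (nat \<times> nat) set" where
  "grid n = {0..1} \<times> {0..n}"

definition liftable :: "nat \<Rightarrow> (nat \<times> nat) rel \<Rightarrow> bool" where
  "liftable n R \<longleftrightarrow>
     (\<forall>i j. i < j \<and> j \<le> n \<and> ((1, i), (1, j)) \<in> R \<longrightarrow> ((0, i), (1, i)) \<in> R)"

definition stationary :: "nat \<Rightarrow> (nat \<times> nat) rel \<Rightarrow> nat \<times> nat \<Rightarrow> bool" where
  "stationary n R x \<longleftrightarrow>
     (\<exists>b\<le>n. x = (1, b) \<and> \<not> (\<exists>c d. c \<le> b \<and> b < d \<and> d \<le> n \<and> ((1, c), (1, d)) \<in> R))"

definition extendable :: "nat \<Rightarrow> (nat \<times> nat) rel \<Rightarrow> nat \<times> nat \<Rightarrow> bool" where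
  "extendable n R x \<longleftrightarrow> (\<exists>b\<le>n. x = (0, b) \<and> ((0, b), (0, n)) \<in> R)"

definition fibrant :: "nat \<Rightarrow> (nat \<times> nat) rel \<Rightarrow> nat \<times> nat \<Rightarrow> bool" where
  "fibrant n R x \<longleftrightarrow> x \<in> grid n \<and> (x, (1, n)) \<in> R"

definition minimal_fibrant :: "nat \<Rightarrow> (nat \<times> nat) rel \<Rightarrow> nat \<times> nat \<Rightarrow> bool" where
  "minimal_fibrant n R x \<longleftrightarrow> fibrant n R x \<and> \<not> (\<exists>y. fibrant n R y \<and> y < x)"

definition L :: "nat \<Rightarrow> (nat \<times> nat) rel set" where
  "L n = {R. transfer_system_on (grid n) R \<and> liftable n R}"

definition L_stat :: "nat \<Rightarrow> nat \<Rightarrow> (nat \<times> nat) rel set" where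
  "L_stat n k = {R \<in> L n. card {x \<in> grid n. stationary n R x} = k}"

definition L_stat_ext :: "nat \<Rightarrow> nat \<Rightarrow> nat \<Rightarrow> (nat \<times> nat) rel set" where
  "L_stat_ext n k l = {R \<in> L_stat n k. card {x \<in> grid n. extendable n R x} = l}"

definition L_stat_ext_fib :: "nat \<Rightarrow> nat \<Rightarrow> nat \<Rightarrow> nat \<times> nat \<Rightarrow> (nat \<times> nat) rel set" where
  "L_stat_ext_fib n k l x = {R \<in> L_stat_ext n k l. minimal_fibrant n R x}"

definition Tam :: "nat \<Rightarrow> (nat \<times> nat) rel set" where
  "Tam n = {R. transfer_system_on (grid n) R \<and> ((0, n), (1, n)) \<in> R}"

definition Tam_stat :: "nat \<Rightarrow> nat \<Rightarrow> (nat \<times> nat) rel set" where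
  "Tam_stat n k = Tam n \<inter> L_stat n k"

text \<open>The element \<open>(1, n)\<close> is always stationary and \<open>(0, n)\<close> always extendable, so the convention
  that the cardinalities vanish for \<open>k\<close> or \<open>l\<close> outside \<open>{1..n + 1}\<close> holds automatically.\<close>

lemma card_stationary_range: "card {x \<in> grid n. stationary n R x} \<in> {1..n + 1}"
proof -
  let ?S = "{x \<in> grid n. stationary n R x}"
  have sub: "?S \<subseteq> Pair 1 ` {0..n}" by (auto simp: stationary_def)
  have "(1, n) \<in> ?S" by (auto simp: stationary_def grid_def)
  moreover have fin: "finite ?S" using sub by (rule finite_subset) simp
  ultimately have "card ?S \<noteq> 0" by auto
  moreover have "card ?S \<le> card (Pair (1::nat) ` {0..n})" using sub by (intro card_mono) auto
  ultimately show ?thesis by (simp add: card_image inj_on_def)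
qed

lemma card_extendable_range:
  assumes "transfer_system_on (grid n) R"
  shows "card {x \<in> grid n. extendable n R x} \<in> {1..n + 1}"
proof -
  let ?S = "{x \<in> grid n. extendable n R x}"
  have sub: "?S \<subseteq> Pair 0 ` {0..n}" by (auto simp: extendable_def)
  have "((0, n), (0, n)) \<in> R" using assms
    by (auto simp: transfer_system_on_def partial_order_on_def preorder_on_def refl_on_def grid_def)
  then have "(0, n) \<in> ?S" by (auto simp: extendable_def grid_def)
  moreover have fin: "finite ?S" using sub by (rule finite_subset) simp
  ultimately have "card ?S \<noteq> 0" by auto
  moreover have "card ?S \<le> card (Pair (0::nat) ` {0..n})" using sub by (intro card_mono) auto
  ultimately show ?thesis by (simp add: card_image inj_on_def)
qed

lemma L_stat_empty: "k \<notin> {1..n + 1} \<Longrightarrow> L_stat n k = {}"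
  using card_stationary_range by (auto simp: L_stat_def)

lemma L_stat_ext_empty: "k \<notin> {1..n + 1} \<or> l \<notin> {1..n + 1} \<Longrightarrow> L_stat_ext n k l = {}"
  using L_stat_empty[of k n] card_extendable_range[of n]
  by (auto simp: L_stat_ext_def L_stat_def L_def)

end

theory Submission
  imports Defs
begin

text \<open>A system whose least fibrant element is \<open>(0, 0)\<close> is determined by its restriction to the
  columns \<open>1..n\<close> and the largest \<open>m\<close> with \<open>(1, 0) R (1, m)\<close>; liftability does not constrain \<open>m\<close>, and the
  admissible \<open>m\<close> are \<open>0\<close> and the stationary columns of the restriction. The stationary columns of the
  whole system are the admissible values \<open>\<ge> m\<close>, so prescribing their number \<open>k\<close> singles out one \<open>m\<close>,
  which exists as soon as the restriction has at least \<open>k - 1\<close> stationary columns.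
  Dually, when only \<open>(1, n)\<close> is fibrant, the system is determined by its restriction to the columns
  \<open>0..n - 1\<close> and an initial segment of the extendable columns of that restriction, namely the \<open>b < n\<close>
  with \<open>(0, b) R (0, n)\<close>. If the least fibrant element is \<open>(0, b)\<close>, no relation crosses from the columns
  left of \<open>b\<close> to the others, and the two parts are arbitrary members of \<open>Tam\<close> and of the first class.\<close>

declare One_nat_def [simp del]

section \<open>Transfer systems on the grid in coordinates\<close>

lemma mem_grid [simp]: "(a, i) \<in> grid n \<longleftrightarrow> a \<le> 1 \<and> i \<le> n"
  by (auto simp: grid_def)

lemma finite_grid [simp]: "finite (grid n)"
  by (simp add: grid_def)

text \<open>The later constructions are defined by cases on coordinates and are checked against
  these four clauses. Antisymmetry is missing because it follows from \<open>R\<close> refining the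
  componentwise order; containment in the grid follows from the bounds \<open>b \<le> 1\<close> and
  \<open>j \<le> n\<close> on the larger element.\<close>

lemma transfer_system_on_grid_iff:
  "transfer_system_on (grid n) R \<longleftrightarrow>
     (\<forall>a i b j. ((a, i), (b, j)) \<in> R \<longrightarrow> a \<le> b \<and> b \<le> 1 \<and> i \<le> j \<and> j \<le> n) \<and>
     (\<forall>a i. a \<le> 1 \<longrightarrow> i \<le> n \<longrightarrow> ((a, i), (a, i)) \<in> R) \<and>
     (\<forall>x y z. (x, y) \<in> R \<longrightarrow> (y, z) \<in> R \<longrightarrow> (x, z) \<in> R) \<and>
     (\<forall>a i b j c k. ((a, i), (b, j)) \<in> R \<longrightarrow> c \<le> b \<longrightarrow> k \<le> j \<longrightarrow>
        ((min a c, min i k), (c, k)) \<in> R)" (is "?L \<longleftrightarrow> ?le \<and> ?refl \<and> ?trans \<and> ?restr")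
proof
  assume L: ?L
  then have sub: "R \<subseteq> grid n \<times> grid n"
    by (auto simp: transfer_system_on_def partial_order_on_def preorder_on_def)
  have le: "x \<le> y" if "(x, y) \<in> R" for x y
    using L that unfolding transfer_system_on_def by blast
  have le': ?le
    using sub le by force
  moreover have ?refl
    using L by (simp add: transfer_system_on_def partial_order_on_def preorder_on_def refl_on_def)
  moreover have ?trans
    using L by (auto simp: transfer_system_on_def partial_order_on_def preorder_on_def trans_def)
  moreover have ?restr
  proof (intro allI impI)
    fix a i b j c k assume R: "((a, i), (b, j)) \<in> R" and "c \<le> b" "k \<le> j"
    moreover from this le' have "b \<le> 1" "j \<le> n" by blast+
    ultimately have "(c, k) \<in> grid n" "(c, k) \<le> (b, j)" by auto
    with L R have "(inf (a, i) (c, k), (c, k)) \<in> R"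
      unfolding transfer_system_on_def by blast
    then show "((min a c, min i k), (c, k)) \<in> R" by (simp add: inf_nat_def)
  qed
  ultimately show "?le \<and> ?refl \<and> ?trans \<and> ?restr" by blast
next
  assume *: "?le \<and> ?refl \<and> ?trans \<and> ?restr"
  note le = *[THEN conjunct1]
    and refl = *[THEN conjunct2, THEN conjunct1]
    and trans = *[THEN conjunct2, THEN conjunct2, THEN conjunct1]
    and restr = *[THEN conjunct2, THEN conjunct2, THEN conjunct2]
  have sub: "R \<subseteq> grid n \<times> grid n"
  proof
    fix p assume p: "p \<in> R"
    obtain a i b j where eq: "p = ((a, i), (b, j))" by (metis surj_pair)
    have "a \<le> b \<and> b \<le> 1 \<and> i \<le> j \<and> j \<le> n"
      using le p unfolding eq by blast
    then show "p \<in> grid n \<times> grid n" by (simp add: eq)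
  qed
  have le': "x \<le> y" if "(x, y) \<in> R" for x y
  proof -
    obtain a i b j where eq: "x = (a, i)" "y = (b, j)" by (metis surj_pair)
    have "a \<le> b \<and> i \<le> j" using le that unfolding eq by blast
    then show ?thesis by (simp add: eq)
  qed
  have "refl_on (grid n) R"
    using refl unfolding refl_on_def by (simp add: split_paired_all)
  moreover have "Relation.trans R" using trans unfolding trans_def by blast
  moreover have "antisym R" using le' by (meson antisymI order.antisym)
  ultimately have "partial_order_on (grid n) R"
    using sub by (simp add: partial_order_on_def preorder_on_def)
  moreover have "(inf x z, z) \<in> R" if xy: "(x, y) \<in> R" and z: "z \<le> y" for x y z
  proof -
    obtain a i b j c k where eq: "x = (a, i)" "y = (b, j)" "z = (c, k)" by (metis surj_pair)
    have "c \<le> b" "k \<le> j" using z by (auto simp: eq)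
    then have "((min a c, min i k), (c, k)) \<in> R" using restr xy unfolding eq by blast
    then show ?thesis by (simp add: eq inf_nat_def)
  qed
  ultimately show ?L
    using le' unfolding transfer_system_on_def by blast
qed

lemma
  assumes "transfer_system_on (grid n) R"
  shows transfer_le: "((a, i), (b, j)) \<in> R \<Longrightarrow> a \<le> b \<and> b \<le> 1 \<and> i \<le> j \<and> j \<le> n"
    and transfer_refl: "a \<le> 1 \<Longrightarrow> i \<le> n \<Longrightarrow> ((a, i), (a, i)) \<in> R"
    and transfer_trans: "(x, y) \<in> R \<Longrightarrow> (y, z) \<in> R \<Longrightarrow> (x, z) \<in> R"
    and transfer_restrict: "((a, i), (b, j)) \<in> R \<Longrightarrow> c \<le> b \<Longrightarrow> k \<le> j \<Longrightarrow>
          ((min a c, min i k), (c, k)) \<in> R"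
proof -
  note * = assms[unfolded transfer_system_on_grid_iff]
  show "((a, i), (b, j)) \<in> R \<Longrightarrow> a \<le> b \<and> b \<le> 1 \<and> i \<le> j \<and> j \<le> n"
    using *[THEN conjunct1] by blast
  show "a \<le> 1 \<Longrightarrow> i \<le> n \<Longrightarrow> ((a, i), (a, i)) \<in> R"
    using *[THEN conjunct2, THEN conjunct1] by blast
  show "(x, y) \<in> R \<Longrightarrow> (y, z) \<in> R \<Longrightarrow> (x, z) \<in> R"
    using *[THEN conjunct2, THEN conjunct2, THEN conjunct1] by blast
  show "((a, i), (b, j)) \<in> R \<Longrightarrow> c \<le> b \<Longrightarrow> k \<le> j \<Longrightarrow>
          ((min a c, min i k), (c, k)) \<in> R"
    using *[THEN conjunct2, THEN conjunct2, THEN conjunct2] by blast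
qed

lemma rel_pair_eqI:
  assumes "\<And>a i b j. ((a, i), (b, j)) \<in> R \<longleftrightarrow> ((a, i), (b, j)) \<in> S"
  shows "R = S"
  using assms by auto

lemma transfer_subset: "transfer_system_on (grid n) R \<Longrightarrow> R \<subseteq> grid n \<times> grid n"
  by (auto simp: transfer_system_on_def partial_order_on_def preorder_on_def)

lemma finite_transfer_systems: "finite {R. transfer_system_on (grid n) R}"
  by (rule finite_subset[of _ "Pow (grid n \<times> grid n)"]) (use transfer_subset in auto)

lemma finite_L: "finite (L n)"
  using finite_transfer_systems by (rule rev_finite_subset) (auto simp: L_def)

section \<open>Stationary and extendable elements as sets of column indices\<close>

definition stationary_cols :: "nat \<Rightarrow> (nat \<times> nat) rel \<Rightarrow> nat set" where
  "stationary_cols n R =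
     {b. b \<le> n \<and> (\<forall>c d. c \<le> b \<longrightarrow> b < d \<longrightarrow> d \<le> n \<longrightarrow> ((1, c), (1, d)) \<notin> R)}"

definition extendable_cols :: "nat \<Rightarrow> (nat \<times> nat) rel \<Rightarrow> nat set" where
  "extendable_cols n R = {b. b \<le> n \<and> ((0, b), (0, n)) \<in> R}"

lemma card_stationary: "card {x \<in> grid n. stationary n R x} = card (stationary_cols n R)"
proof -
  have "{x \<in> grid n. stationary n R x} = Pair 1 ` stationary_cols n R"
    by (auto simp: stationary_def stationary_cols_def)
  then show ?thesis by (simp add: card_image inj_on_def)
qed

lemma card_extendable: "card {x \<in> grid n. extendable n R x} = card (extendable_cols n R)"
proof -
  have "{x \<in> grid n. extendable n R x} = Pair 0 ` extendable_cols n R"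
    by (auto simp: extendable_def extendable_cols_def)
  then show ?thesis by (simp add: card_image inj_on_def)
qed

lemma finite_stationary_cols [simp]: "finite (stationary_cols n R)"
  by (rule finite_subset[of _ "{..n}"]) (auto simp: stationary_cols_def)

lemma finite_extendable_cols [simp]: "finite (extendable_cols n R)"
  by (rule finite_subset[of _ "{..n}"]) (auto simp: extendable_cols_def)

lemma card_stationary_cols: "card (stationary_cols n R) \<in> {1..n + 1}"
  using card_stationary_range[of n R] by (simp add: card_stationary)

lemma card_extendable_cols: "R \<in> L n \<Longrightarrow> card (extendable_cols n R) \<in> {1..n + 1}"
  using card_extendable_range[of n R] by (simp add: card_extendable L_def)

lemma mem_L_stat: "R \<in> L_stat n k \<longleftrightarrow> R \<in> L n \<and> card (stationary_cols n R) = k"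
  by (simp add: L_stat_def card_stationary)

lemma mem_L_stat_ext: "R \<in> L_stat_ext n k l \<longleftrightarrow>
    R \<in> L n \<and> card (stationary_cols n R) = k \<and> card (extendable_cols n R) = l"
  by (simp add: L_stat_ext_def mem_L_stat card_extendable conj_assoc)

lemma mem_L_stat_ext_fib: "R \<in> L_stat_ext_fib n k l x \<longleftrightarrow>
    R \<in> L n \<and> card (stationary_cols n R) = k \<and> card (extendable_cols n R) = l
      \<and> minimal_fibrant n R x"
  by (simp add: L_stat_ext_fib_def mem_L_stat_ext conj_assoc)

lemma finite_L_stat_ext [simp]: "finite (L_stat_ext n k l)"
  using finite_L by (rule rev_finite_subset) (auto simp: mem_L_stat_ext)

lemma finite_L_stat_ext_fib [simp]: "finite (L_stat_ext_fib n k l x)"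
  using finite_L by (rule rev_finite_subset) (auto simp: mem_L_stat_ext_fib)

lemma finite_Tam_stat [simp]: "finite (Tam_stat n k)"
  using finite_L by (rule rev_finite_subset) (auto simp: Tam_stat_def mem_L_stat)

section \<open>Fibrant elements and the partition of \<open>L n\<close>\<close>

lemma fibrant_inf:
  assumes "transfer_system_on (grid n) R" "fibrant n R x" "fibrant n R y"
  shows "fibrant n R (inf x y)"
proof -
  have R: "(x, (1, n)) \<in> R" "(y, (1, n)) \<in> R" "y \<in> grid n" "x \<in> grid n"
    using assms by (auto simp: fibrant_def)
  have "y \<le> (1, n)" using assms(1) R unfolding transfer_system_on_def by blast
  \<comment> \<open>Restrict the relation from \<open>x\<close> to \<open>(1, n)\<close> along
    \<open>y \<le> (1, n)\<close>; composing with the relation from \<open>y\<close> to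
    \<open>(1, n)\<close> then makes the meet fibrant.\<close>
  then have "(inf x y, y) \<in> R"
    using assms(1) R unfolding transfer_system_on_def by blast
  then have "(inf x y, (1, n)) \<in> R"
    using transfer_trans[OF assms(1)] R by blast
  moreover have "inf x y \<in> grid n"
    using R by (cases x; cases y) (auto simp: inf_nat_def)
  ultimately show ?thesis by (simp add: fibrant_def)
qed

text \<open>Minimal means least here: the meet of a minimal fibrant \<open>x\<close> with any
  fibrant \<open>y\<close> is again fibrant and cannot lie strictly below \<open>x\<close>, so it
  equals \<open>x\<close>.\<close>

lemma minimal_fibrant_iff:
  assumes "transfer_system_on (grid n) R"
  shows "minimal_fibrant n R x \<longleftrightarrow>
    (x, (1, n)) \<in> R \<and> (\<forall>y. (y, (1, n)) \<in> R \<longrightarrow> x \<le> y)"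
proof -
  have fib: "fibrant n R y \<longleftrightarrow> (y, (1, n)) \<in> R" for y
    using transfer_subset[OF assms] by (auto simp: fibrant_def)
  show ?thesis
  proof
    assume min: "minimal_fibrant n R x"
    then have x: "fibrant n R x" by (simp add: minimal_fibrant_def)
    have "x \<le> y" if "(y, (1, n)) \<in> R" for y
    proof -
      have "fibrant n R (inf x y)" using fibrant_inf[OF assms x] that by (simp add: fib)
      with min have "\<not> inf x y < x" unfolding minimal_fibrant_def by blast
      then have "inf x y = x" using inf_le1[of x y] unfolding less_le by blast
      then show ?thesis unfolding le_iff_inf .
    qed
    with x[unfolded fib] show "(x, (1, n)) \<in> R \<and> (\<forall>y. (y, (1, n)) \<in> R \<longrightarrow> x \<le> y)" by blast
  next
    assume "(x, (1, n)) \<in> R \<and> (\<forall>y. (y, (1, n)) \<in> R \<longrightarrow> x \<le> y)"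
    then show "minimal_fibrant n R x"
      unfolding minimal_fibrant_def fib less_le_not_le by blast
  qed
qed

lemma minimal_fibrant_le:
  assumes "transfer_system_on (grid n) R" "minimal_fibrant n R x" "(y, (1, n)) \<in> R"
  shows "x \<le> y"
  using assms(2)[unfolded minimal_fibrant_iff[OF assms(1)], THEN conjunct2, rule_format, OF assms(3)] .

lemma minimal_fibrant_unique:
  assumes "transfer_system_on (grid n) R" "minimal_fibrant n R x" "minimal_fibrant n R y"
  shows "x = y"
  using assms by (meson minimal_fibrant_iff order.antisym)

lemma minimal_fibrant_exists:
  assumes "transfer_system_on (grid n) R"
  shows "\<exists>x \<in> grid n. minimal_fibrant n R x"
proof -
  have "finite {x. fibrant n R x}"
    by (rule finite_subset[OF _ finite_grid[of n]]) (auto simp: fibrant_def)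
  moreover have "(1, n) \<in> {x. fibrant n R x}"
    using transfer_refl[OF assms, of 1 n] by (simp add: fibrant_def)
  ultimately obtain x where "x \<in> {x. fibrant n R x}" "\<forall>y \<in> {x. fibrant n R x}. \<not> y < x"
    by (metis finite_has_minimal empty_iff less_le_not_le)
  then have "minimal_fibrant n R x" by (auto simp: minimal_fibrant_def)
  then show ?thesis by (auto simp: minimal_fibrant_def fibrant_def)
qed

text \<open>The classes are disjoint because a system determines its two cardinalities and its
  minimal fibrant element. They exhaust \<open>L n\<close> because both cardinalities always lie in
  \<open>{1..n + 1}\<close> and a minimal fibrant element exists.\<close>

lemma card_L_eq_sum:
  "card (L n) = (\<Sum>(k, l, x) \<in> {1..n + 1} \<times> {1..n + 1} \<times> grid n. card (L_stat_ext_fib n k l x))"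
proof -
  have "L n = (\<Union>(k, l, x) \<in> {1..n + 1} \<times> {1..n + 1} \<times> grid n. L_stat_ext_fib n k l x)"
  proof (intro equalityI subsetI)
    fix R assume R: "R \<in> L n"
    then obtain x where "x \<in> grid n" "minimal_fibrant n R x"
      using minimal_fibrant_exists unfolding L_def by blast
    with R card_stationary_cols[of n R] card_extendable_cols[OF R]
    show "R \<in> (\<Union>(k, l, x) \<in> {1..n + 1} \<times> {1..n + 1} \<times> grid n. L_stat_ext_fib n k l x)"
      by (intro UN_I[of "(card (stationary_cols n R), card (extendable_cols n R), x)"])
         (auto simp: mem_L_stat_ext_fib)
  qed (auto simp: mem_L_stat_ext_fib)
  also have "card \<dots> = (\<Sum>p \<in> {1..n + 1} \<times> {1..n + 1} \<times> grid n.
      card (case p of (k, l, x) \<Rightarrow> L_stat_ext_fib n k l x))"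
    by (rule card_UN_disjoint)
      (auto simp: mem_L_stat_ext_fib L_def dest: minimal_fibrant_unique)
  finally show ?thesis by (simp add: case_prod_unfold)
qed

text \<open>If \<open>(1, b)\<close> with \<open>b < n\<close> is fibrant, liftability relates
  \<open>(0, b)\<close> to \<open>(1, b)\<close>, so by composition \<open>(0, b)\<close> is fibrant
  as well, and \<open>(1, b)\<close> is not the least fibrant element.\<close>

lemma card_fib_upper_row:
  assumes "b < n"
  shows "card (L_stat_ext_fib n k l (1, b)) = 0"
proof -
  have "R \<notin> L_stat_ext_fib n k l (1, b)" for R
  proof
    assume R: "R \<in> L_stat_ext_fib n k l (1, b)"
    then have ts: "transfer_system_on (grid n) R" and lift: "liftable n R"
      and min: "minimal_fibrant n R (1, b)"
      by (auto simp: mem_L_stat_ext_fib L_def)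
    from min have b: "((1, b), (1, n)) \<in> R" by (simp add: minimal_fibrant_iff[OF ts])
    with lift assms have "((0, b), (1, b)) \<in> R" by (auto simp: liftable_def)
    with b have "((0, b), (1, n)) \<in> R" using transfer_trans[OF ts] by blast
    then have "(1::nat, b) \<le> (0, b)" by (rule minimal_fibrant_le[OF ts min])
    then show False by simp
  qed
  then have "L_stat_ext_fib n k l (1, b) = {}" by blast
  then show ?thesis by simp
qed

section \<open>Restriction to an interval of columns\<close>

definition slice :: "nat \<Rightarrow> nat \<Rightarrow> (nat \<times> nat) rel \<Rightarrow> (nat \<times> nat) rel" where
  "slice s m R = {((a, i), (b, j)) | a i b j. i \<le> m \<and> j \<le> m \<and> ((a, i + s), (b, j + s)) \<in> R}"

lemma mem_slice [simp]:
  "((a, i), (b, j)) \<in> slice s m R \<longleftrightarrow> i \<le> m \<and> j \<le> m \<and> ((a, i + s), (b, j + s)) \<in> R"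
  by (simp add: slice_def)

text \<open>The columns \<open>s\<close> to \<open>s + m\<close> are renumbered from
  \<open>0\<close>. This shift commutes with \<open>min\<close>, so restriction in the slice is
  restriction in the whole system between shifted elements.\<close>

lemma transfer_slice:
  assumes "transfer_system_on (grid n) R" "s + m \<le> n"
  shows "transfer_system_on (grid m) (slice s m R)"
  unfolding transfer_system_on_grid_iff
proof (intro conjI allI impI)
  fix x y z assume "(x, y) \<in> slice s m R" "(y, z) \<in> slice s m R"
  then show "(x, z) \<in> slice s m R"
    using transfer_trans[OF assms(1)] by (cases x; cases y; cases z) auto
next
  fix a i b j c k assume "((a, i), (b, j)) \<in> slice s m R" "c \<le> b" "k \<le> j"
  then show "((min a c, min i k), (c, k)) \<in> slice s m R"
    using transfer_restrict[OF assms(1), of a "i + s" b "j + s" c "k + s"]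
    by (auto simp: min_add_distrib_left)
qed (use assms(2) in \<open>auto dest: transfer_le[OF assms(1)] intro: transfer_refl[OF assms(1)]\<close>)

lemma slice_in_L:
  assumes "R \<in> L n" "s + m \<le> n"
  shows "slice s m R \<in> L m"
proof -
  have "transfer_system_on (grid m) (slice s m R)"
    using assms transfer_slice[of n R s m] by (simp add: L_def)
  moreover have "((0, i + s), (1, i + s)) \<in> R"
    if "i < j" "j \<le> m" "((1, i + s), (1, j + s)) \<in> R" for i j
  proof -
    have "i + s < j + s" "j + s \<le> n" using that assms(2) by auto
    then show ?thesis using assms(1) that(3) unfolding L_def liftable_def by blast
  qed
  ultimately show ?thesis by (auto simp: L_def liftable_def)
qed

lemma liftableD:
  "liftable n R \<Longrightarrow> ((1, i), (1, j)) \<in> R \<Longrightarrow> i < j \<Longrightarrow> j \<le> n \<Longrightarrow> ((0, i), (1, i)) \<in> R"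
  unfolding liftable_def by blast

text \<open>A recursion that sums over one statistic counts a single set of systems; that set is the
  target of the bijection given by restriction.\<close>

lemma sum_card_L_stat_ext_over_ext:
  assumes "finite A"
  shows "(\<Sum>l\<in>A. card (L_stat_ext n k l)) =
    card {R \<in> L n. card (stationary_cols n R) = k \<and> card (extendable_cols n R) \<in> A}"
proof -
  have "{R \<in> L n. card (stationary_cols n R) = k \<and> card (extendable_cols n R) \<in> A}
      = (\<Union>l\<in>A. L_stat_ext n k l)"
    by (auto simp: mem_L_stat_ext)
  moreover have "card (\<Union>l\<in>A. L_stat_ext n k l) = (\<Sum>l\<in>A. card (L_stat_ext n k l))"
    using assms by (intro card_UN_disjoint) (auto simp: mem_L_stat_ext)
  ultimately show ?thesis by simp
qed

lemma sum_card_L_stat_ext_over_stat: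
  assumes "finite A"
  shows "(\<Sum>k\<in>A. card (L_stat_ext n k l)) =
    card {R \<in> L n. card (stationary_cols n R) \<in> A \<and> card (extendable_cols n R) = l}"
proof -
  have "{R \<in> L n. card (stationary_cols n R) \<in> A \<and> card (extendable_cols n R) = l}
      = (\<Union>k\<in>A. L_stat_ext n k l)"
    by (auto simp: mem_L_stat_ext)
  moreover have "card (\<Union>k\<in>A. L_stat_ext n k l) = (\<Sum>k\<in>A. card (L_stat_ext n k l))"
    using assms by (intro card_UN_disjoint) (auto simp: mem_L_stat_ext)
  ultimately show ?thesis by simp
qed

section \<open>Initial and final segments of finite linear orders\<close>

lemma initial_segment_unique:
  fixes E :: "'a::linorder set"
  assumes "finite E" "F \<subseteq> E" "G \<subseteq> E" "card F = card G"
    and F: "\<And>x y. x \<in> F \<Longrightarrow> y \<in> E \<Longrightarrow> y \<le> x \<Longrightarrow> y \<in> F"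
    and G: "\<And>x y. x \<in> G \<Longrightarrow> y \<in> E \<Longrightarrow> y \<le> x \<Longrightarrow> y \<in> G"
  shows "F = G"
proof -
  have "finite F" "finite G" using assms(1-3) by (auto intro: finite_subset)
  \<comment> \<open>Given an element of \<open>F\<close> outside \<open>G\<close> and one of
    \<open>G\<close> outside \<open>F\<close>, the smaller of the two would belong to the other set
    by downward closure. Comparable finite sets of equal size coincide.\<close>
  moreover have "F \<subseteq> G \<or> G \<subseteq> F"
  proof (rule ccontr)
    assume "\<not> ?thesis"
    then obtain x y where xy: "x \<in> F" "x \<notin> G" "y \<in> G" "y \<notin> F" by blast
    then show False
      using F[of x y] G[of y x] assms(2,3) by (cases x y rule: linorder_le_cases) auto
  qed
  ultimately show ?thesis
    using assms(4) card_subset_eq[of F G] card_subset_eq[of G F] by auto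
qed

text \<open>The segment grows by the least missing element of \<open>E\<close>. It will serve as the
  set of columns joined to a new last column, of which only the size is prescribed.\<close>

lemma initial_segment_exists:
  fixes E :: "'a::linorder set"
  assumes "finite E" "l \<le> card E"
  shows "\<exists>F\<subseteq>E. card F = l \<and> (\<forall>x\<in>F. \<forall>y\<in>E. y \<le> x \<longrightarrow> y \<in> F)"
  using assms(2)
proof (induction l)
  case 0
  show ?case by (intro exI[of _ "{}"]) simp
next
  case (Suc l)
  then obtain F where F: "F \<subseteq> E" "card F = l" "\<forall>x\<in>F. \<forall>y\<in>E. y \<le> x \<longrightarrow> y \<in> F" by auto
  have fin: "finite F" using F(1) assms(1) finite_subset by blast
  have ne: "E - F \<noteq> {}" using Suc.prems F(1,2) by (metis Diff_eq_empty_iff Suc_n_not_le_n subset_antisym)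
  define x where "x = Min (E - F)"
  have x: "x \<in> E - F" unfolding x_def using ne assms(1) by (intro Min_in) auto
  have min: "x \<le> y" if "y \<in> E - F" for y
    unfolding x_def using that assms(1) by (intro Min_le) auto
  show ?case
  proof (intro exI[of _ "insert x F"] conjI ballI impI)
    fix u v assume "u \<in> insert x F" "v \<in> E" "v \<le> u"
    then show "v \<in> insert x F" using F(3) min by (metis DiffI insert_iff order.antisym)
  qed (use F x fin in auto)
qed

text \<open>Moving the starting point up loses at least the old starting point, so the size of a
  final segment determines where in \<open>S\<close> it starts. This recovers the parameter
  \<open>m\<close> of a prepended column from the number of stationary columns.\<close>

lemma final_segment_unique:
  fixes S :: "'a::linorder set"
  assumes "finite S" "m \<in> S" "m' \<in> S" "card {s\<in>S. m \<le> s} = card {s\<in>S. m' \<le> s}"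
  shows "m = m'"
proof -
  have less: "card {s\<in>S. b \<le> s} < card {s\<in>S. a \<le> s}" if "a < b" "a \<in> S" for a b
  proof (rule psubset_card_mono)
    show "finite {s\<in>S. a \<le> s}" using assms(1) by simp
    show "{s\<in>S. b \<le> s} \<subset> {s\<in>S. a \<le> s}" using that by force
  qed
  show ?thesis using less[of m m'] less[of m' m] assms by (metis less_irrefl linorder_less_linear)
qed

text \<open>Start at the maximum of \<open>S\<close> and pass each time to the greatest element
  below the current \<open>m\<close>, which lengthens the segment by one.\<close>

lemma final_segment_exists:
  fixes S :: "'a::linorder set"
  assumes "finite S" "Suc k \<le> card S"
  shows "\<exists>m\<in>S. card {s\<in>S. m \<le> s} = Suc k"
  using assms(2)
proof (induction k)
  case 0
  then have "S \<noteq> {}" by auto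
  then have "Max S \<in> S" using assms(1) by simp
  moreover from this have "{s\<in>S. Max S \<le> s} = {Max S}"
    using Max_ge[OF assms(1)] by (auto intro: order.antisym simp del: Max_ge_iff Max_le_iff)
  ultimately show ?case by (intro bexI[of _ "Max S"]) simp_all
next
  case (Suc k)
  then obtain m where m: "m \<in> S" "card {s\<in>S. m \<le> s} = Suc k" by auto
  \<comment> \<open>Otherwise the segment from \<open>m\<close> would be all of \<open>S\<close>,
    which has more than \<open>Suc k\<close> elements.\<close>
  have "{s\<in>S. s < m} \<noteq> {}"
  proof
    assume "{s\<in>S. s < m} = {}"
    then have "{s\<in>S. m \<le> s} = S" by force
    with m(2) Suc.prems show False by simp
  qed
  then have mem: "Max {s\<in>S. s < m} \<in> {s\<in>S. s < m}" using assms(1) by (intro Max_in) auto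
  define m' where "m' = Max {s\<in>S. s < m}"
  have "s \<le> m'" if "s \<in> S" "s < m" for s
    unfolding m'_def using that assms(1) by (intro Max_ge) auto
  then have "{s\<in>S. m' \<le> s} = insert m' {s\<in>S. m \<le> s}"
    using mem unfolding m'_def[symmetric] by force
  moreover have "m' \<notin> {s\<in>S. m \<le> s}" using mem unfolding m'_def[symmetric] by force
  ultimately have "card {s\<in>S. m' \<le> s} = Suc (Suc k)" using m(2) assms(1) by simp
  then show ?case using mem unfolding m'_def[symmetric] by blast
qed

section \<open>Appending a last column: only the top element is fibrant\<close>

definition append_column :: "nat \<Rightarrow> nat set \<Rightarrow> (nat \<times> nat) rel \<Rightarrow> (nat \<times> nat) rel" where
  "append_column n F R = R \<union> (\<lambda>b. ((0, b), (0, Suc n))) ` F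
     \<union> {((0, Suc n), (0, Suc n)), ((1, Suc n), (1, Suc n))}"

lemma mem_append_column: "((a, i), (b, j)) \<in> append_column n F R \<longleftrightarrow> ((a, i), (b, j)) \<in> R
    \<or> a = 0 \<and> b = 0 \<and> j = Suc n \<and> (i \<in> F \<or> i = Suc n)
    \<or> a = 1 \<and> b = 1 \<and> i = Suc n \<and> j = Suc n"
  by (auto simp: append_column_def)

context
  fixes n R F
  assumes ts: "transfer_system_on (grid n) R"
    and F: "F \<subseteq> extendable_cols n R"
    and F_down: "\<And>x y. x \<in> F \<Longrightarrow> y \<in> extendable_cols n R \<Longrightarrow> y \<le> x \<Longrightarrow> y \<in> F"
begin

text \<open>Transitivity needs \<open>F\<close> to be an initial segment: if \<open>(0, i)\<close>
  is related to \<open>(0, j)\<close> with \<open>j \<in> F\<close>, then \<open>i\<close> is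
  extendable and \<open>i \<le> j\<close>, hence \<open>i \<in> F\<close>. Restricting a new
  relation from \<open>(0, i)\<close> to \<open>(0, Suc n)\<close> to an old column works because
  \<open>i\<close> is extendable in \<open>R\<close>.\<close>

lemma transfer_append_column: "transfer_system_on (grid (Suc n)) (append_column n F R)"
  unfolding transfer_system_on_grid_iff
proof (intro conjI allI impI)
  fix a i b j assume "((a, i), (b, j)) \<in> append_column n F R"
  then show "a \<le> b" "b \<le> 1" "i \<le> j" "j \<le> Suc n"
    using F by (auto simp: mem_append_column extendable_cols_def dest!: transfer_le[OF ts])
next
  fix a i assume "a \<le> (1::nat)" "i \<le> Suc n"
  then show "((a, i), (a, i)) \<in> append_column n F R"
    using transfer_refl[OF ts, of a i] by (auto simp: mem_append_column le_Suc_eq One_nat_def)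
next
  fix x y z assume "(x, y) \<in> append_column n F R" "(y, z) \<in> append_column n F R"
  moreover obtain a i b j c k where eq: "x = (a, i)" "y = (b, j)" "z = (c, k)" by (metis surj_pair)
  moreover have "a = 0 \<and> i \<in> F" if R: "((a, i), (0, j)) \<in> R" and j: "j \<in> F"
  proof -
    have a: "a = 0" "i \<le> j" "j \<le> n" using transfer_le[OF ts R] by auto
    have "((0, j), (0, n)) \<in> R" using j F by (auto simp: extendable_cols_def)
    then have "i \<in> extendable_cols n R"
      using transfer_trans[OF ts R] a by (auto simp: extendable_cols_def)
    then show ?thesis using F_down[OF j] a by simp
  qed
  ultimately show "(x, z) \<in> append_column n F R"
    using F by (auto simp: mem_append_column extendable_cols_def dest: transfer_le[OF ts] intro: transfer_trans[OF ts])
next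
  fix a i b j c k
  assume A: "((a, i), (b, j)) \<in> append_column n F R" "c \<le> b" "k \<le> j"
  then consider "((a, i), (b, j)) \<in> R" | "a = 0" "b = 0" "j = Suc n" "i \<in> F"
    | "a = b" "i = j" "j = Suc n" "a \<le> 1"
    by (auto simp: mem_append_column)
  then show "((min a c, min i k), (c, k)) \<in> append_column n F R"
  proof cases
    case 1
    then show ?thesis using transfer_restrict[OF ts] A by (simp add: mem_append_column)
  next
    case 2
    then have i: "((0, i), (0, n)) \<in> R" using F by (auto simp: extendable_cols_def)
    show ?thesis
    proof (cases "k = Suc n")
      case True
      then show ?thesis using 2 A transfer_le[OF ts i] by (simp add: mem_append_column)
    next
      case False
      then show ?thesis using 2 A transfer_restrict[OF ts i, of 0 k] by (simp add: mem_append_column)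
    qed
  next
    case 3
    then have "min a c = c" "min i k = k" using A by auto
    then show ?thesis
      using 3 A transfer_refl[OF ts, of c k] by (auto simp: mem_append_column le_Suc_eq One_nat_def)
  qed
qed

lemma slice_append_column: "slice 0 n (append_column n F R) = R"
  by (rule rel_pair_eqI) (auto simp: mem_append_column dest: transfer_le[OF ts])

lemma extendable_cols_append_column: "extendable_cols (Suc n) (append_column n F R) = insert (Suc n) F"
  using F by (auto simp: extendable_cols_def mem_append_column dest: transfer_le[OF ts])

text \<open>The only relation into \<open>(1, Suc n)\<close> is the reflexive one, so no old column
  loses stationarity; the last column has nothing after it.\<close>

lemma stationary_cols_append_column:
  "stationary_cols (Suc n) (append_column n F R) = insert (Suc n) (stationary_cols n R)"
  by (auto simp: stationary_cols_def mem_append_column le_Suc_eq dest: transfer_le[OF ts])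

lemma liftable_append_column: "liftable n R \<Longrightarrow> liftable (Suc n) (append_column n F R)"
  by (auto simp: liftable_def mem_append_column le_Suc_eq dest: transfer_le[OF ts])

lemma minimal_fibrant_append_column: "minimal_fibrant (Suc n) (append_column n F R) (1, Suc n)"
  unfolding minimal_fibrant_iff[OF transfer_append_column]
  by (auto simp: mem_append_column dest: transfer_le[OF ts])

end

text \<open>Restriction of a relation from \<open>(0, b)\<close> to \<open>(0, Suc n)\<close> shows
  that \<open>b\<close> is extendable in the slice. For downward closure, take
  \<open>y \<le> x\<close> with \<open>(0, y)\<close> related to \<open>(0, n)\<close>: restricting
  to \<open>(0, x)\<close> and composing with the relation from \<open>(0, x)\<close> to
  \<open>(0, Suc n)\<close> shows that \<open>y\<close> is in \<open>F\<close>.\<close>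

lemma append_column_slice:
  assumes ts: "transfer_system_on (grid (Suc n)) R"
    and min: "minimal_fibrant (Suc n) R (1, Suc n)"
  defines "F \<equiv> extendable_cols (Suc n) R - {Suc n}"
  shows "append_column n F (slice 0 n R) = R"
    and "F \<subseteq> extendable_cols n (slice 0 n R)"
    and "\<And>x y. x \<in> F \<Longrightarrow> y \<in> extendable_cols n (slice 0 n R) \<Longrightarrow> y \<le> x \<Longrightarrow> y \<in> F"
proof -
  show sub: "F \<subseteq> extendable_cols n (slice 0 n R)"
  proof
    fix b assume "b \<in> F"
    then have "b \<le> n" "((0, b), (0, Suc n)) \<in> R" by (auto simp: F_def extendable_cols_def le_Suc_eq)
    then show "b \<in> extendable_cols n (slice 0 n R)"
      using transfer_restrict[OF ts, of 0 b 0 "Suc n" 0 n] by (simp add: extendable_cols_def)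
  qed
  show "y \<in> F" if x: "x \<in> F" and y: "y \<in> extendable_cols n (slice 0 n R)" and le: "y \<le> x" for x y
  proof -
    have "((0, y), (0, n)) \<in> R" "y \<le> n" using y by (auto simp: extendable_cols_def)
    moreover have x': "((0, x), (0, Suc n)) \<in> R" "x \<le> n"
      using x by (auto simp: F_def extendable_cols_def le_Suc_eq)
    ultimately have "((0, y), (0, x)) \<in> R"
      using transfer_restrict[OF ts, of 0 y 0 n 0 x] le by (simp add: min_absorb1)
    then have "((0, y), (0, Suc n)) \<in> R" using x' transfer_trans[OF ts] by blast
    then show ?thesis using \<open>y \<le> n\<close> by (auto simp: F_def extendable_cols_def)
  qed
  show "append_column n F (slice 0 n R) = R"
  proof (rule rel_pair_eqI)
    fix a i b j
    show "((a, i), (b, j)) \<in> append_column n F (slice 0 n R) \<longleftrightarrow> ((a, i), (b, j)) \<in> R" (is "?L \<longleftrightarrow> ?R")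
    proof
      assume ?L
      then show ?R
        using transfer_refl[OF ts, of _ "Suc n"] by (auto simp: mem_append_column F_def extendable_cols_def)
    next
      assume R: ?R
      then have le: "a \<le> b" "b \<le> 1" "i \<le> j" "j \<le> Suc n" using transfer_le[OF ts] by blast+
      show ?L
      proof (cases "j = Suc n")
        case True
        show ?thesis
        proof (cases "b = 0")
          case True
          then show ?thesis using R le \<open>j = Suc n\<close> by (auto simp: mem_append_column F_def extendable_cols_def)
        next
          case False
          with le have "b = 1" by simp
          \<comment> \<open>The source of a relation into \<open>(1, Suc n)\<close> is fibrant, and
            the least fibrant element is already the top.\<close>
          then have "(1, Suc n) \<le> (a, i)"
            using minimal_fibrant_le[OF ts min, of "(a, i)"] R True by simp
          then show ?thesis using le True \<open>b = 1\<close> by (simp add: mem_append_column)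
        qed
      qed (use R le in \<open>auto simp: mem_append_column\<close>)
    qed
  qed
qed

text \<open>The last column contributes one stationary and one extendable column. What remains is an
  initial segment of size \<open>l - 1\<close> among the extendable columns of the restriction; it
  is unique, and it exists exactly when there are at least \<open>l - 1\<close> of them. The upper
  limit \<open>Suc n\<close> is the largest number of extendable columns possible in
  \<open>L n\<close>.\<close>

lemma card_fib_top:
  assumes "1 \<le> k" "1 \<le> l"
  shows "card (L_stat_ext_fib (Suc n) k l (1, Suc n)) =
    (\<Sum>l' = l - 1..Suc n. card (L_stat_ext n (k - 1) l'))"
proof -
  let ?A = "L_stat_ext_fib (Suc n) k l (1, Suc n)"
  let ?B = "{R \<in> L n. card (stationary_cols n R) = k - 1 \<and> card (extendable_cols n R) \<in> {l - 1..Suc n}}"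
  have "bij_betw (slice 0 n) ?A ?B"
  proof (rule bij_betw_imageI)
    have A: "R = append_column n (extendable_cols (Suc n) R - {Suc n}) (slice 0 n R)
        \<and> slice 0 n R \<in> ?B \<and> card (extendable_cols (Suc n) R - {Suc n}) = l - 1
        \<and> extendable_cols (Suc n) R - {Suc n} \<subseteq> extendable_cols n (slice 0 n R)
        \<and> (\<forall>x \<in> extendable_cols (Suc n) R - {Suc n}. \<forall>y \<in> extendable_cols n (slice 0 n R).
             y \<le> x \<longrightarrow> y \<in> extendable_cols (Suc n) R - {Suc n})"
      if R: "R \<in> ?A" for R
    proof -
      define F where "F = extendable_cols (Suc n) R - {Suc n}"
      have ts: "transfer_system_on (grid (Suc n)) R" and RL: "R \<in> L (Suc n)"
        and min: "minimal_fibrant (Suc n) R (1, Suc n)"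
        and k: "card (stationary_cols (Suc n) R) = k"
        and l: "card (extendable_cols (Suc n) R) = l"
        using R by (auto simp: mem_L_stat_ext_fib L_def)
      note cs = append_column_slice[OF ts min, folded F_def]
      have RL': "slice 0 n R \<in> L n" using slice_in_L[OF RL, of 0 n] by simp
      then have ts': "transfer_system_on (grid n) (slice 0 n R)" by (simp add: L_def)
      have "Suc n \<in> extendable_cols (Suc n) R"
        using transfer_refl[OF ts, of 0 "Suc n"] by (simp add: extendable_cols_def)
      then have cardF: "card F = l - 1" using l by (simp add: F_def)
      then have l': "l - 1 \<le> card (extendable_cols n (slice 0 n R))"
        using card_mono[OF _ cs(2)] by simp
      have "stationary_cols (Suc n) R = insert (Suc n) (stationary_cols n (slice 0 n R))"
        using stationary_cols_append_column[OF ts' cs(2,3)] cs(1) by simp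
      moreover have "Suc n \<notin> stationary_cols n (slice 0 n R)" by (simp add: stationary_cols_def)
      ultimately have "card (stationary_cols n (slice 0 n R)) = k - 1" using k by simp
      then show ?thesis
        using cs RL' l' cardF card_extendable_cols[OF RL'] unfolding F_def[symmetric] by auto
    qed
    note A_eq = A[THEN conjunct1]
      and A_B = A[THEN conjunct2, THEN conjunct1]
      and A_card = A[THEN conjunct2, THEN conjunct2, THEN conjunct1]
      and A_sub = A[THEN conjunct2, THEN conjunct2, THEN conjunct2, THEN conjunct1]
      and A_down = A[THEN conjunct2, THEN conjunct2, THEN conjunct2, THEN conjunct2, rule_format]
    show "inj_on (slice 0 n) ?A"
    proof (rule inj_onI)
      fix R S assume R: "R \<in> ?A" and S: "S \<in> ?A" and eq: "slice 0 n R = slice 0 n S"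
      \<comment> \<open>Both are initial segments of size \<open>l - 1\<close> in the extendable
        columns of the common slice.\<close>
      have "extendable_cols (Suc n) R - {Suc n} = extendable_cols (Suc n) S - {Suc n}"
      proof (rule initial_segment_unique)
        show "finite (extendable_cols n (slice 0 n R))" by simp
        show "card (extendable_cols (Suc n) R - {Suc n}) = card (extendable_cols (Suc n) S - {Suc n})"
          using A_card[OF R] A_card[OF S] by simp
      qed (fact A_sub[OF R] A_sub[OF S, folded eq] A_down[OF R] A_down[OF S, folded eq])+
      then show "R = S" by (subst A_eq[OF R], subst A_eq[OF S]) (simp only: eq)
    qed
    show "slice 0 n ` ?A = ?B"
    proof (intro equalityI subsetI)
      fix R assume R: "R \<in> ?B"
      then have ts: "transfer_system_on (grid n) R" by (simp add: L_def)
      obtain F where F: "F \<subseteq> extendable_cols n R" "card F = l - 1"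
        "\<forall>x\<in>F. \<forall>y\<in>extendable_cols n R. y \<le> x \<longrightarrow> y \<in> F"
        using initial_segment_exists[of "extendable_cols n R" "l - 1"] R by auto
      then have F_down: "\<And>x y. x \<in> F \<Longrightarrow> y \<in> extendable_cols n R \<Longrightarrow> y \<le> x \<Longrightarrow> y \<in> F" by blast
      note facts = transfer_append_column[OF ts F(1) F_down] liftable_append_column[OF ts F(1) F_down]
        stationary_cols_append_column[OF ts F(1) F_down] extendable_cols_append_column[OF ts F(1) F_down]
        minimal_fibrant_append_column[OF ts F(1) F_down] slice_append_column[OF ts F(1) F_down]
      have fin: "finite F" using F(1) finite_extendable_cols finite_subset by blast
      have new: "Suc n \<notin> F" "Suc n \<notin> stationary_cols n R"
        using F(1) by (auto simp: extendable_cols_def stationary_cols_def)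
      have "append_column n F R \<in> ?A"
        using facts(1-5) R F(2) assms fin new by (auto simp: mem_L_stat_ext_fib L_def)
      then show "R \<in> slice 0 n ` ?A" using facts(6) by force
    qed (use A_B in auto)
  qed
  then show ?thesis
    using sum_card_L_stat_ext_over_ext[of "{l - 1..Suc n}" n "k - 1"]
    by (simp add: bij_betw_same_card)
qed

section \<open>Prepending a first column: the bottom element is fibrant\<close>

definition prepend_column :: "nat \<Rightarrow> nat \<Rightarrow> (nat \<times> nat) rel \<Rightarrow> (nat \<times> nat) rel" where
  "prepend_column n m R = {((a, i), (b, j)) | a i b j.
     a = 0 \<and> i = 0 \<and> b \<le> 1 \<and> j \<le> Suc n
     \<or> a = 1 \<and> i = 0 \<and> b = 1 \<and> j \<le> m
     \<or> 1 \<le> i \<and> 1 \<le> j \<and> ((a, i - 1), (b, j - 1)) \<in> R}"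

lemma mem_prepend_column: "((a, i), (b, j)) \<in> prepend_column n m R \<longleftrightarrow>
     a = 0 \<and> i = 0 \<and> b \<le> 1 \<and> j \<le> Suc n
     \<or> a = 1 \<and> i = 0 \<and> b = 1 \<and> j \<le> m
     \<or> 1 \<le> i \<and> 1 \<le> j \<and> ((a, i - 1), (b, j - 1)) \<in> R"
  by (simp add: prepend_column_def)

context
  fixes n R m
  assumes ts: "transfer_system_on (grid n) R"
    and m: "m \<in> insert 0 (Suc ` stationary_cols n R)"
begin

lemma prepend_column_bound_le: "m \<le> Suc n"
  using m by (auto simp: stationary_cols_def)

text \<open>A relation violating this would jump over column \<open>m - 1\<close> of
  \<open>R\<close>, which is stationary whenever \<open>m > 0\<close>. Transitivity depends on it: a
  relation from \<open>(1, 0)\<close> to \<open>(1, j)\<close> with \<open>j \<le> m\<close>,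
  followed by a shifted relation of \<open>R\<close>, must not end beyond \<open>m\<close>.\<close>

lemma prepend_column_bound_stationary:
  assumes "((1, c), (1, d)) \<in> R" "Suc c \<le> m"
  shows "Suc d \<le> m"
proof (rule ccontr)
  assume "\<not> Suc d \<le> m"
  moreover obtain s where s: "m = Suc s" "s \<in> stationary_cols n R" using m assms(2) by auto
  ultimately have "c \<le> s" "s < d" "d \<le> n" using assms transfer_le[OF ts assms(1)] by auto
  then show False using s(2) assms(1) by (auto simp: stationary_cols_def)
qed

text \<open>Composition is delicate only for relations out of \<open>(1, 0)\<close>, where the
  choice of \<open>m\<close> enters through \<open>prepend_column_bound_stationary\<close>.
  Restrictions to column \<open>0\<close> are reflexive or start at \<open>(0, 0)\<close>, which is
  related to everything.\<close>

lemma transfer_prepend_column: "transfer_system_on (grid (Suc n)) (prepend_column n m R)"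
  unfolding transfer_system_on_grid_iff
proof (intro conjI allI impI)
  fix a i b j assume R: "((a, i), (b, j)) \<in> prepend_column n m R"
  have "a \<le> b \<and> b \<le> 1 \<and> i \<le> j \<and> j \<le> Suc n"
    using R prepend_column_bound_le transfer_le[OF ts, of a "i - 1" b "j - 1"] unfolding mem_prepend_column by linarith
  then show "a \<le> b" "b \<le> 1" "i \<le> j" "j \<le> Suc n" by auto
next
  fix a i assume "a \<le> (1::nat)" "i \<le> Suc n"
  then show "((a, i), (a, i)) \<in> prepend_column n m R"
    using transfer_refl[OF ts, of a "i - 1"] unfolding mem_prepend_column by linarith
next
  fix x y z assume R: "(x, y) \<in> prepend_column n m R" "(y, z) \<in> prepend_column n m R"
  obtain a i b j c k where eq: "x = (a, i)" "y = (b, j)" "z = (c, k)" by (metis surj_pair)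
  have ck: "c \<le> 1" "k \<le> Suc n"
    using R(2) prepend_column_bound_le transfer_le[OF ts, of b "j - 1" c "k - 1"] unfolding eq mem_prepend_column by linarith+
  consider "a = 0" "i = 0" | "a = 1" "i = 0" "b = 1" "j \<le> m"
    | "1 \<le> i" "1 \<le> j" "((a, i - 1), (b, j - 1)) \<in> R"
    using R(1) unfolding eq mem_prepend_column by blast
  then show "(x, z) \<in> prepend_column n m R"
  proof cases
    case 1
    then show ?thesis using ck by (simp add: eq mem_prepend_column)
  next
    case 2
    show ?thesis
    proof (cases "j = 0")
      case True
      then show ?thesis using R(2) 2 by (simp add: eq mem_prepend_column)
    next
      case False
      then have k: "1 \<le> k" "((1, j - 1), (c, k - 1)) \<in> R"
        using R(2) 2 by (auto simp: eq mem_prepend_column)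
      then have "c = 1" using transfer_le[OF ts k(2)] by simp
      then have "k \<le> m" using prepend_column_bound_stationary[of "j - 1" "k - 1"] k 2 False by simp
      then show ?thesis using 2 \<open>c = 1\<close> by (simp add: eq mem_prepend_column)
    qed
  next
    case 3
    then have "1 \<le> k" "((b, j - 1), (c, k - 1)) \<in> R" using R(2) by (auto simp: eq mem_prepend_column)
    then show ?thesis using 3 transfer_trans[OF ts] unfolding eq mem_prepend_column by blast
  qed
next
  fix a i b j c k
  assume R: "((a, i), (b, j)) \<in> prepend_column n m R" and le: "c \<le> b" "k \<le> j"
  then consider "a = 0" "i = 0" "b \<le> 1" "j \<le> Suc n" | "a = 1" "i = 0" "b = 1" "j \<le> m"
    | "1 \<le> i" "1 \<le> j" "((a, i - 1), (b, j - 1)) \<in> R"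
    unfolding mem_prepend_column by blast
  then show "((min a c, min i k), (c, k)) \<in> prepend_column n m R"
  proof cases
    case 1
    then show ?thesis using le by (simp add: mem_prepend_column)
  next
    case 2
    then have "c = 0 \<or> c = 1" using le by auto
    then show ?thesis using 2 le prepend_column_bound_le by (auto simp: mem_prepend_column)
  next
    case 3
    have ab: "a \<le> b" "b \<le> 1" using transfer_le[OF ts 3(3)] by auto
    show ?thesis
    proof (cases "k = 0")
      case True
      have "min a c = 0 \<or> min a c = 1 \<and> c = 1" using ab le by auto
      then show ?thesis using True ab le by (auto simp: mem_prepend_column)
    next
      case False
      then have "((min a c, min (i - 1) (k - 1)), (c, k - 1)) \<in> R"
        using transfer_restrict[OF ts 3(3) le(1), of "k - 1"] le by simp
      moreover have "min (i - 1) (k - 1) = min i k - 1" by simp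
      ultimately show ?thesis using 3(1) False by (simp add: mem_prepend_column)
    qed
  qed
qed

lemma slice_prepend_column: "slice 1 n (prepend_column n m R) = R"
  by (rule rel_pair_eqI) (auto simp: mem_prepend_column dest: transfer_le[OF ts])

lemma extendable_cols_prepend_column:
  "extendable_cols (Suc n) (prepend_column n m R) = insert 0 (Suc ` extendable_cols n R)"
proof (rule set_eqI)
  fix b show "b \<in> extendable_cols (Suc n) (prepend_column n m R) \<longleftrightarrow> b \<in> insert 0 (Suc ` extendable_cols n R)"
    by (cases b) (auto simp: extendable_cols_def mem_prepend_column)
qed

text \<open>The relation from \<open>(1, 0)\<close> to \<open>(1, m)\<close> jumps over every column
  before \<open>m\<close>. No relation out of \<open>(1, 0)\<close> passes beyond \<open>m\<close>,
  so from there on stationarity is that of \<open>R\<close>, shifted by one. Column \<open>0\<close>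
  survives precisely when \<open>m = 0\<close>.\<close>

lemma stationary_cols_prepend_column:
  "stationary_cols (Suc n) (prepend_column n m R) = {s \<in> insert 0 (Suc ` stationary_cols n R). m \<le> s}"
proof (intro equalityI subsetI)
  fix s assume s: "s \<in> stationary_cols (Suc n) (prepend_column n m R)"
  have "m \<le> s"
  proof (rule ccontr)
    assume "\<not> m \<le> s"
    then have "((1, 0), (1, m)) \<notin> prepend_column n m R"
      using s prepend_column_bound_le by (auto simp: stationary_cols_def)
    then show False by (simp add: mem_prepend_column)
  qed
  moreover have "t \<in> stationary_cols n R" if t: "s = Suc t" for t
  proof -
    have "((1, c), (1, d)) \<notin> R" if "c \<le> t" "t < d" "d \<le> n" for c d
    proof -
      have "((1, Suc c), (1, Suc d)) \<notin> prepend_column n m R"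
        using s that t by (auto simp: stationary_cols_def)
      then show ?thesis by (simp add: mem_prepend_column)
    qed
    then show ?thesis using s t by (auto simp: stationary_cols_def)
  qed
  ultimately show "s \<in> {s \<in> insert 0 (Suc ` stationary_cols n R). m \<le> s}"
    by (cases s) auto
next
  fix s assume s: "s \<in> {s \<in> insert 0 (Suc ` stationary_cols n R). m \<le> s}"
  then have "s \<le> Suc n" by (auto simp: stationary_cols_def)
  moreover have "((1, c), (1, d)) \<notin> prepend_column n m R" if "c \<le> s" "s < d" "d \<le> Suc n" for c d
  proof
    assume "((1, c), (1, d)) \<in> prepend_column n m R"
    then have R: "1 \<le> c" "((1, c - 1), (1, d - 1)) \<in> R" using that s by (auto simp: mem_prepend_column)
    then have "s \<noteq> 0" using that(1) by simp
    then obtain t where "s = Suc t" "t \<in> stationary_cols n R" using s by auto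
    then show False using R that by (auto simp: stationary_cols_def)
  qed
  ultimately show "s \<in> stationary_cols (Suc n) (prepend_column n m R)" by (simp add: stationary_cols_def)
qed

lemma liftable_prepend_column:
  assumes "liftable n R"
  shows "liftable (Suc n) (prepend_column n m R)"
  unfolding liftable_def
proof (intro allI impI)
  fix i j assume A: "i < j \<and> j \<le> Suc n \<and> ((1, i), (1, j)) \<in> prepend_column n m R"
  show "((0, i), (1, i)) \<in> prepend_column n m R"
  proof (cases "i = 0")
    case False
    then have "((1, i - 1), (1, j - 1)) \<in> R" using A by (simp add: mem_prepend_column)
    moreover have "i - 1 < j - 1" "j - 1 \<le> n" using A False by linarith+
    ultimately have "((0, i - 1), (1, i - 1)) \<in> R" by (rule liftableD[OF assms])
    then show ?thesis using False by (simp add: mem_prepend_column)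
  qed (simp add: mem_prepend_column)
qed

lemma minimal_fibrant_prepend_column: "minimal_fibrant (Suc n) (prepend_column n m R) (0, 0)"
  unfolding minimal_fibrant_iff[OF transfer_prepend_column] by (auto simp: mem_prepend_column)

end

text \<open>Take for \<open>m\<close> the last column reached from \<open>(1, 0)\<close> in the
  upper row. An upper-row relation from one of the columns \<open>1..m\<close> to a column beyond
  \<open>m\<close> would, preceded by a relation out of \<open>(1, 0)\<close>, contradict this
  choice; so column \<open>m - 1\<close> of the slice is stationary if \<open>m > 0\<close>.\<close>

lemma prepend_column_slice:
  assumes ts: "transfer_system_on (grid (Suc n)) R"
    and min: "((0, 0), (1, Suc n)) \<in> R"
  shows "\<exists>m \<in> insert 0 (Suc ` stationary_cols n (slice 1 n R)). prepend_column n m (slice 1 n R) = R"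
proof -
  have bot: "((0, 0), (b, j)) \<in> R" if "b \<le> 1" "j \<le> Suc n" for b j
    using transfer_restrict[OF ts min that] by simp
  define D where "D = {d. d \<le> Suc n \<and> ((1, 0), (1, d)) \<in> R}"
  define m where "m = Max D"
  have "0 \<in> D" using transfer_refl[OF ts, of 1 0] by (simp add: D_def)
  moreover have finD: "finite D" by (simp add: D_def)
  ultimately have mD: "m \<in> D" unfolding m_def by (intro Max_in) auto
  then have m: "m \<le> Suc n" "((1, 0), (1, m)) \<in> R" by (auto simp: D_def)
  have max: "d \<le> m" if "((1, 0), (1, d)) \<in> R" for d
    using that transfer_le[OF ts that] finD unfolding m_def by (intro Max_ge) (auto simp: D_def)
  \<comment> \<open>Restriction fills in all columns up to \<open>m\<close>, so the single number
    \<open>m\<close> records every relation out of \<open>(1, 0)\<close>.\<close>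
  have down: "((1, 0), (1, d)) \<in> R" if "d \<le> m" for d
    using transfer_restrict[OF ts m(2), of 1 d] that by simp
  have "m \<in> insert 0 (Suc ` stationary_cols n (slice 1 n R))"
  proof (cases m)
    case (Suc t)
    have "((1, Suc c), (1, Suc d)) \<notin> R" if "c \<le> t" "t < d" for c d
    proof
      assume "((1, Suc c), (1, Suc d)) \<in> R"
      then have "((1, 0), (1, Suc d)) \<in> R"
        using transfer_trans[OF ts down[of "Suc c"]] that Suc by simp
      then show False using max that Suc by fastforce
    qed
    then have "t \<in> stationary_cols n (slice 1 n R)" using Suc m by (auto simp: stationary_cols_def One_nat_def)
    then show ?thesis using Suc by simp
  qed simp
  moreover have "prepend_column n m (slice 1 n R) = R"
  proof (rule rel_pair_eqI)
    fix a i b j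
    show "((a, i), (b, j)) \<in> prepend_column n m (slice 1 n R) \<longleftrightarrow> ((a, i), (b, j)) \<in> R" (is "?L \<longleftrightarrow> ?R")
    proof
      assume ?L
      then show ?R using bot down by (auto simp: mem_prepend_column)
    next
      assume R: ?R
      note le = transfer_le[OF ts R]
      show ?L
      proof (cases "i = 0")
        case True
        have "a = 0 \<or> a = 1 \<and> b = 1" using le by auto
        then show ?thesis using True le max R by (auto simp: mem_prepend_column)
      next
        case False
        then have "i - 1 \<le> n \<and> j - 1 \<le> n" using le by linarith
        then show ?thesis using False R le by (simp add: mem_prepend_column)
      qed
    qed
  qed
  ultimately show ?thesis by blast
qed

text \<open>If the restriction has \<open>t\<close> stationary columns, there are
  \<open>t + 1\<close> admissible values of \<open>m\<close>, and the final segments they start have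
  the sizes \<open>1..t + 1\<close>. Hence \<open>k\<close> is attained by exactly one
  \<open>m\<close> if \<open>k - 1 \<le> t\<close> and by none otherwise. Column \<open>0\<close> is
  always extendable, which leaves \<open>l - 1\<close> for the restriction.\<close>

lemma card_fib_bottom:
  assumes "1 \<le> k" "1 \<le> l"
  shows "card (L_stat_ext_fib (Suc n) k l (0, 0)) =
    (\<Sum>k' = k - 1..Suc n. card (L_stat_ext n k' (l - 1)))"
proof -
  let ?A = "L_stat_ext_fib (Suc n) k l (0, 0)"
  let ?B = "{R \<in> L n. card (stationary_cols n R) \<in> {k - 1..Suc n} \<and> card (extendable_cols n R) = l - 1}"
  \<comment> \<open>The admissible values of \<open>m\<close>.\<close>
  let ?S = "\<lambda>R. insert 0 (Suc ` stationary_cols n R)"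
  have fin: "finite (?S R)" and cardS: "card (?S R) = Suc (card (stationary_cols n R))"
    and cardE: "card (insert 0 (Suc ` extendable_cols n R)) = Suc (card (extendable_cols n R))" for R
    by (simp_all add: card_image)
  have "bij_betw (slice 1 n) ?A ?B"
  proof (rule bij_betw_imageI)
    have A: "\<exists>m \<in> ?S (slice 1 n R). prepend_column n m (slice 1 n R) = R
        \<and> card {s \<in> ?S (slice 1 n R). m \<le> s} = k" (is ?ex)
      and A_B: "slice 1 n R \<in> ?B"
      if R: "R \<in> ?A" for R
    proof -
      have ts: "transfer_system_on (grid (Suc n)) R" and RL: "R \<in> L (Suc n)"
        and min: "minimal_fibrant (Suc n) R (0, 0)"
        and k: "card (stationary_cols (Suc n) R) = k"
        and l: "card (extendable_cols (Suc n) R) = l"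
        using R by (auto simp: mem_L_stat_ext_fib L_def)
      from min have "((0, 0), (1, Suc n)) \<in> R" unfolding minimal_fibrant_iff[OF ts] by simp
      then obtain m where m: "m \<in> ?S (slice 1 n R)" "prepend_column n m (slice 1 n R) = R"
        using prepend_column_slice[OF ts] by blast
      have RL': "slice 1 n R \<in> L n" using slice_in_L[OF RL, of 1 n] by simp
      then have ts': "transfer_system_on (grid n) (slice 1 n R)" by (simp add: L_def)
      have k': "card {s \<in> ?S (slice 1 n R). m \<le> s} = k"
        using stationary_cols_prepend_column[OF ts' m(1)] m(2) k by simp
      then show ?ex using m by blast
      have "k \<le> Suc (card (stationary_cols n (slice 1 n R)))"
        using card_mono[OF fin, of "{s \<in> ?S (slice 1 n R). m \<le> s}" "slice 1 n R"] k' cardS by auto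
      moreover have "Suc (card (extendable_cols n (slice 1 n R))) = l"
        using extendable_cols_prepend_column[OF ts' m(1)] m(2) l cardE by simp
      ultimately show "slice 1 n R \<in> ?B"
        using RL' card_stationary_cols[of n "slice 1 n R"] by auto
    qed
    show "inj_on (slice 1 n) ?A"
    proof (rule inj_onI)
      fix R S assume R: "R \<in> ?A" and S: "S \<in> ?A" and eq: "slice 1 n R = slice 1 n S"
      obtain m where m: "m \<in> ?S (slice 1 n R)" "prepend_column n m (slice 1 n R) = R"
        "card {s \<in> ?S (slice 1 n R). m \<le> s} = k" using A[OF R] by blast
      obtain m' where m': "m' \<in> ?S (slice 1 n R)" "prepend_column n m' (slice 1 n R) = S"
        "card {s \<in> ?S (slice 1 n R). m' \<le> s} = k" using A[OF S, folded eq] by blast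
      have "m = m'" using final_segment_unique[OF fin m(1) m'(1)] m(3) m'(3) by simp
      then show "R = S" using m(2) m'(2) by simp
    qed
    show "slice 1 n ` ?A = ?B"
    proof (intro equalityI subsetI)
      fix R assume R: "R \<in> ?B"
      then have ts: "transfer_system_on (grid n) R" and lift: "liftable n R" by (auto simp: L_def)
      have "Suc (k - 1) \<le> card (?S R)" using R cardS by simp
      from final_segment_exists[OF fin this]
      obtain m where m: "m \<in> ?S R" and "card {s \<in> ?S R. m \<le> s} = Suc (k - 1)" by blast
      then have k: "card {s \<in> ?S R. m \<le> s} = k" using assms(1) by simp
      have "prepend_column n m R \<in> ?A"
        using transfer_prepend_column[OF ts m] liftable_prepend_column[OF ts m lift] stationary_cols_prepend_column[OF ts m]
          extendable_cols_prepend_column[OF ts m] minimal_fibrant_prepend_column[OF ts m] R k cardE assms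
        by (simp add: mem_L_stat_ext_fib L_def)
      then show "R \<in> slice 1 n ` ?A" using slice_prepend_column[OF ts m] by force
    qed (use A_B in auto)
  qed
  then show ?thesis
    using sum_card_L_stat_ext_over_stat[of "{k - 1..Suc n}" n "l - 1"]
    by (simp add: bij_betw_same_card)
qed

section \<open>Gluing two systems with no relation between them\<close>

definition glue :: "nat \<Rightarrow> (nat \<times> nat) rel \<Rightarrow> (nat \<times> nat) rel \<Rightarrow> (nat \<times> nat) rel" where
  "glue s R S = R \<union> {((a, i), (b, j)) | a i b j. s \<le> i \<and> s \<le> j \<and> ((a, i - s), (b, j - s)) \<in> S}"

lemma mem_glue: "((a, i), (b, j)) \<in> glue s R S \<longleftrightarrow>
    ((a, i), (b, j)) \<in> R \<or> s \<le> i \<and> s \<le> j \<and> ((a, i - s), (b, j - s)) \<in> S"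
  by (simp add: glue_def)

lemma Tam_column:
  assumes "R \<in> Tam n" "i \<le> n"
  shows "((0, i), (1, i)) \<in> R"
proof -
  have ts: "transfer_system_on (grid n) R" and R: "((0, n), (1, n)) \<in> R"
    using assms(1) by (auto simp: Tam_def)
  show ?thesis using transfer_restrict[OF ts R, of 1 i] assms(2) by simp
qed

text \<open>The vertical relation in the last column restricts to every column, so the conclusion of
  liftability holds outright.\<close>

lemma Tam_subset_L: "Tam n \<subseteq> L n"
proof
  fix R assume "R \<in> Tam n"
  then show "R \<in> L n"
    using Tam_column[of R n] by (auto simp: L_def Tam_def liftable_def)
qed

lemma mem_Tam_stat: "R \<in> Tam_stat n k \<longleftrightarrow> R \<in> Tam n \<and> card (stationary_cols n R) = k"
  using Tam_subset_L by (auto simp: Tam_stat_def mem_L_stat)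

context
  fixes c m R S
  assumes R: "R \<in> Tam c" and S: "S \<in> L m" and S_bot: "((0, 0), (1, m)) \<in> S"
begin

lemma glue_transfer: "transfer_system_on (grid c) R" "transfer_system_on (grid m) S"
  using R S by (auto simp: Tam_def L_def)

text \<open>Every relation stays in one block: the columns \<open>0..c\<close> carry
  \<open>R\<close>, and the later ones carry \<open>S\<close> shifted by
  \<open>Suc c\<close>.\<close>

lemma mem_glue_cases:
  assumes "((a, i), (b, j)) \<in> glue (Suc c) R S"
  obtains "((a, i), (b, j)) \<in> R" "a \<le> b" "b \<le> 1" "i \<le> j" "j \<le> c"
    | i' j' where "i = i' + Suc c" "j = j' + Suc c" "((a, i'), (b, j')) \<in> S"
        "a \<le> b" "b \<le> 1" "i' \<le> j'" "j' \<le> m"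
proof -
  have "((a, i), (b, j)) \<in> R \<or> Suc c \<le> i \<and> Suc c \<le> j \<and> ((a, i - Suc c), (b, j - Suc c)) \<in> S"
    using assms by (simp add: mem_glue)
  then show thesis
  proof (elim disjE conjE)
    assume RR: "((a, i), (b, j)) \<in> R"
    from transfer_le[OF glue_transfer(1) RR] show thesis by (intro that(1) RR) auto
  next
    assume "Suc c \<le> i" "Suc c \<le> j" and SS: "((a, i - Suc c), (b, j - Suc c)) \<in> S"
    then show thesis
      using transfer_le[OF glue_transfer(2) SS] by (intro that(2)[OF _ _ SS]) auto
  qed
qed

lemma glue_shifted: "((a, i + Suc c), (b, j + Suc c)) \<in> glue (Suc c) R S \<longleftrightarrow> ((a, i), (b, j)) \<in> S"
  using transfer_le[OF glue_transfer(1), of a "i + Suc c" b "j + Suc c"] by (auto simp: mem_glue)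

text \<open>The blocks interact only when a relation of the right block is restricted to some
  \<open>(d, k)\<close> with \<open>k \<le> c\<close>. The meet is then \<open>(d, k)\<close>
  itself, or \<open>(0, k)\<close> with \<open>d = 1\<close>; the second case is the reason for
  requiring \<open>R \<in> Tam c\<close>, which supplies all vertical relations of the left
  block.\<close>

lemma transfer_glue: "transfer_system_on (grid (m + Suc c)) (glue (Suc c) R S)"
  unfolding transfer_system_on_grid_iff
proof (intro conjI allI impI)
  fix a i b j assume "((a, i), (b, j)) \<in> glue (Suc c) R S"
  then have "a \<le> b \<and> b \<le> 1 \<and> i \<le> j \<and> j \<le> m + Suc c"
    by (cases rule: mem_glue_cases) auto
  then show "a \<le> b" "b \<le> 1" "i \<le> j" "j \<le> m + Suc c" by auto
next
  fix a i assume "a \<le> (1::nat)" "i \<le> m + Suc c"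
  then show "((a, i), (a, i)) \<in> glue (Suc c) R S"
    using transfer_refl[OF glue_transfer(1), of a i]
      transfer_refl[OF glue_transfer(2), of a "i - Suc c"]
    unfolding mem_glue by linarith
next
  fix x y z assume A: "(x, y) \<in> glue (Suc c) R S" "(y, z) \<in> glue (Suc c) R S"
  obtain a i b j d k where eq: "x = (a, i)" "y = (b, j)" "z = (d, k)" by (metis surj_pair)
  from A(1)[unfolded eq] show "(x, z) \<in> glue (Suc c) R S"
  proof (cases rule: mem_glue_cases)
    case 1
    then have "((b, j), (d, k)) \<in> R" using A(2) by (auto simp: eq mem_glue)
    with 1 show ?thesis using transfer_trans[OF glue_transfer(1)] unfolding eq mem_glue by blast
  next
    case (2 i' j')
    from A(2)[unfolded eq] obtain k' where k: "k = k' + Suc c" "((b, j'), (d, k')) \<in> S"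
      by (cases rule: mem_glue_cases) (use 2 in auto)
    have "((a, i'), (d, k')) \<in> S" using transfer_trans[OF glue_transfer(2)] 2 k by blast
    then show ?thesis unfolding eq 2 k glue_shifted .
  qed
next
  fix a i b j d k
  assume A: "((a, i), (b, j)) \<in> glue (Suc c) R S" and le: "d \<le> b" "k \<le> j"
  from A show "((min a d, min i k), (d, k)) \<in> glue (Suc c) R S"
  proof (cases rule: mem_glue_cases)
    case 1
    then show ?thesis using transfer_restrict[OF glue_transfer(1) _ le] by (simp add: mem_glue)
  next
    case (2 i' j')
    show ?thesis
    proof (cases "k \<le> c")
      case True
      have "min a d = d \<or> min a d = 0 \<and> d = 1" using 2 le by auto
      moreover have "((d, k), (d, k)) \<in> R"
        using transfer_refl[OF glue_transfer(1)] True le 2 by simp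
      moreover have "((0, k), (1, k)) \<in> R" using Tam_column[OF R True] .
      ultimately show ?thesis using True 2(1) by (auto simp: mem_glue)
    next
      case False
      then obtain k' where k: "k = k' + Suc c" by (metis add.commute le_Suc_ex not_less_eq_eq)
      then have "((min a d, min i' k'), (d, k')) \<in> S"
        using transfer_restrict[OF glue_transfer(2) 2(3)] le 2 by simp
      moreover have "min i k = min i' k' + Suc c" using k 2 by simp
      ultimately show ?thesis using k glue_shifted by simp
    qed
  qed
qed

lemma liftable_glue: "liftable (m + Suc c) (glue (Suc c) R S)"
  unfolding liftable_def
proof (intro allI impI, elim conjE)
  fix i j assume ij: "i < j" "j \<le> m + Suc c" and "((1, i), (1, j)) \<in> glue (Suc c) R S"
  from this(3) show "((0, i), (1, i)) \<in> glue (Suc c) R S"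
  proof (cases rule: mem_glue_cases)
    case 1
    then show ?thesis using Tam_column[OF R, of i] by (simp add: mem_glue)
  next
    case (2 i' j')
    then have "((0, i'), (1, i')) \<in> S" using ij S by (auto simp: L_def intro: liftableD)
    then show ?thesis unfolding 2 glue_shifted .
  qed
qed

lemma minimal_fibrant_glue:
  "minimal_fibrant (m + Suc c) (glue (Suc c) R S) (0, Suc c)"
  unfolding minimal_fibrant_iff[OF transfer_glue]
proof (intro conjI allI impI)
  show "((0, Suc c), (1, m + Suc c)) \<in> glue (Suc c) R S"
    using glue_shifted[of 0 0 1 m] S_bot by simp
next
  fix y assume y: "(y, (1, m + Suc c)) \<in> glue (Suc c) R S"
  obtain a i where eq: "y = (a, i)" by (cases y)
  from y[unfolded eq] show "(0, Suc c) \<le> y"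
    by (cases rule: mem_glue_cases) (auto simp: eq)
qed

lemma slice_glue: "slice 0 c (glue (Suc c) R S) = R" "slice (Suc c) m (glue (Suc c) R S) = S"
proof -
  show "slice 0 c (glue (Suc c) R S) = R"
    by (rule rel_pair_eqI) (auto simp: mem_glue dest: transfer_le[OF glue_transfer(1)])
  show "slice (Suc c) m (glue (Suc c) R S) = S"
  proof (rule rel_pair_eqI)
    fix a i b j
    show "((a, i), (b, j)) \<in> slice (Suc c) m (glue (Suc c) R S) \<longleftrightarrow> ((a, i), (b, j)) \<in> S"
      unfolding mem_slice glue_shifted by (auto dest: transfer_le[OF glue_transfer(2)])
  qed
qed

text \<open>The last column lies in the right block, and nothing in the left block reaches
  it.\<close>

lemma extendable_cols_glue:
  "extendable_cols (m + Suc c) (glue (Suc c) R S) = (\<lambda>i. i + Suc c) ` extendable_cols m S"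
proof (intro equalityI subsetI)
  fix b assume "b \<in> extendable_cols (m + Suc c) (glue (Suc c) R S)"
  then have "((0, b), (0, m + Suc c)) \<in> glue (Suc c) R S" by (simp add: extendable_cols_def)
  then show "b \<in> (\<lambda>i. i + Suc c) ` extendable_cols m S"
  proof (cases rule: mem_glue_cases)
    case (2 i' j')
    then show ?thesis by (intro image_eqI[of _ _ i']) (auto simp: extendable_cols_def)
  qed simp
next
  fix b assume "b \<in> (\<lambda>i. i + Suc c) ` extendable_cols m S"
  then obtain i where "b = i + Suc c" "i \<le> m" "((0, i), (0, m)) \<in> S"
    by (auto simp: extendable_cols_def)
  then show "b \<in> extendable_cols (m + Suc c) (glue (Suc c) R S)"
    using glue_shifted[of 0 i 0 m] by (simp add: extendable_cols_def)
qed

text \<open>A relation that jumps over a column has both ends in the block of that column.\<close>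

lemma stationary_cols_glue:
  "stationary_cols (m + Suc c) (glue (Suc c) R S) =
     stationary_cols c R \<union> (\<lambda>i. i + Suc c) ` stationary_cols m S"
proof (intro equalityI subsetI)
  fix b assume b: "b \<in> stationary_cols (m + Suc c) (glue (Suc c) R S)"
  then have not: "((1, x), (1, y)) \<notin> glue (Suc c) R S"
    if "x \<le> b" "b < y" "y \<le> m + Suc c" for x y
    using that by (simp add: stationary_cols_def)
  show "b \<in> stationary_cols c R \<union> (\<lambda>i. i + Suc c) ` stationary_cols m S"
  proof (cases "b \<le> c")
    case True
    have "((1, x), (1, y)) \<notin> R" if "x \<le> b" "b < y" "y \<le> c" for x y
      using not[of x y] that by (simp add: mem_glue)
    then show ?thesis using True by (simp add: stationary_cols_def)
  next
    case False
    then obtain b' where b': "b = b' + Suc c" by (metis add.commute le_Suc_ex not_less_eq_eq)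
    have "((1, x), (1, y)) \<notin> S" if "x \<le> b'" "b' < y" "y \<le> m" for x y
      using not[of "x + Suc c" "y + Suc c"] that unfolding glue_shifted b' by simp
    then have "b' \<in> stationary_cols m S" using b b' by (simp add: stationary_cols_def)
    then show ?thesis using b' by blast
  qed
next
  fix b assume "b \<in> stationary_cols c R \<union> (\<lambda>i. i + Suc c) ` stationary_cols m S"
  then consider "b \<in> stationary_cols c R" | b' where "b = b' + Suc c" "b' \<in> stationary_cols m S"
    by blast
  then show "b \<in> stationary_cols (m + Suc c) (glue (Suc c) R S)"
  proof cases
    case 1
    have "((1, x), (1, y)) \<notin> glue (Suc c) R S" if xy: "x \<le> b" "b < y" for x y
    proof
      assume "((1, x), (1, y)) \<in> glue (Suc c) R S"
      then show False
        by (cases rule: mem_glue_cases) (use 1 xy in \<open>auto simp: stationary_cols_def\<close>)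
    qed
    then show ?thesis using 1 by (simp add: stationary_cols_def)
  next
    case 2
    have "((1, x), (1, y)) \<notin> glue (Suc c) R S" if xy: "x \<le> b" "b < y" for x y
    proof
      assume "((1, x), (1, y)) \<in> glue (Suc c) R S"
      then show False
        by (cases rule: mem_glue_cases) (use 2 xy in \<open>auto simp: stationary_cols_def\<close>)
    qed
    then show ?thesis using 2 by (simp add: stationary_cols_def)
  qed
qed

lemma card_extendable_cols_glue:
  "card (extendable_cols (m + Suc c) (glue (Suc c) R S)) = card (extendable_cols m S)"
  unfolding extendable_cols_glue by (intro card_image) (simp add: inj_on_def)

lemma card_stationary_cols_glue:
  "card (stationary_cols (m + Suc c) (glue (Suc c) R S)) =
     card (stationary_cols c R) + card (stationary_cols m S)"
proof -
  have "stationary_cols c R \<inter> (\<lambda>i. i + Suc c) ` stationary_cols m S = {}"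
    by (auto simp: stationary_cols_def)
  then show ?thesis
    unfolding stationary_cols_glue by (simp add: card_Un_disjoint card_image inj_on_def)
qed

end

text \<open>A relation from \<open>(a, i)\<close> with \<open>i \<le> c\<close> to a later column
  restricts to one from \<open>(0, i)\<close> to \<open>(0, Suc c)\<close>. As
  \<open>(0, Suc c)\<close> is fibrant, so would be \<open>(0, i)\<close>, which is not above the
  least fibrant element. Hence the blocks are unrelated. Restricting the fibrancy of
  \<open>(0, Suc c)\<close> to \<open>(1, c)\<close> puts the left block into
  \<open>Tam c\<close>.\<close>

lemma glue_slice:
  assumes ts: "transfer_system_on (grid (m + Suc c)) R"
    and min: "minimal_fibrant (m + Suc c) R (0, Suc c)"
  shows "glue (Suc c) (slice 0 c R) (slice (Suc c) m R) = R"
    and "slice 0 c R \<in> Tam c"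
    and "((0, 0), (1, m)) \<in> slice (Suc c) m R"
proof -
  have top: "((0, Suc c), (1, m + Suc c)) \<in> R"
    using min unfolding minimal_fibrant_iff[OF ts] by blast
  then show "((0, 0), (1, m)) \<in> slice (Suc c) m R" by simp
  have "((0, c), (1, c)) \<in> R" using transfer_restrict[OF ts top, of 1 c] by simp
  then show "slice 0 c R \<in> Tam c"
    using transfer_slice[OF ts, of 0 c] by (simp add: Tam_def)
  have no_cross: "j \<le> c" if ij: "((a, i), (b, j)) \<in> R" and i: "i \<le> c" for a i b j
  proof (rule ccontr)
    assume "\<not> j \<le> c"
    then have "((0, i), (0, Suc c)) \<in> R"
      using transfer_restrict[OF ts ij, of 0 "Suc c"] i by (simp add: min_absorb1)
    then have "((0, i), (1, m + Suc c)) \<in> R" using transfer_trans[OF ts] top by blast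
    from minimal_fibrant_le[OF ts min this] i show False by simp
  qed
  show "glue (Suc c) (slice 0 c R) (slice (Suc c) m R) = R"
  proof (rule rel_pair_eqI)
    fix a i b j
    show "((a, i), (b, j)) \<in> glue (Suc c) (slice 0 c R) (slice (Suc c) m R) \<longleftrightarrow> ((a, i), (b, j)) \<in> R"
      (is "?L \<longleftrightarrow> ?R")
    proof
      assume R: ?R
      note le = transfer_le[OF ts R]
      show ?L
      proof (cases "i \<le> c")
        case True
        then show ?thesis using R no_cross[OF R] by (simp add: mem_glue)
      next
        case False
        then show ?thesis using R le by (auto simp: mem_glue)
      qed
    qed (auto simp: mem_glue)
  qed
qed

text \<open>Gluing adds the numbers of stationary columns and takes the extendable ones from the
  right block alone. The terms \<open>i = 0\<close> and \<open>i = k\<close> vanish, since every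
  system has a stationary column.\<close>

lemma card_fib_lower_row:
  "card (L_stat_ext_fib (m + Suc c) k l (0, Suc c)) =
    (\<Sum>i = 0..k. card (Tam_stat c i) * card (L_stat_ext_fib m (k - i) l (0, 0)))"
proof -
  let ?A = "L_stat_ext_fib (m + Suc c) k l (0, Suc c)"
  let ?B = "\<Union>i\<in>{0..k}. Tam_stat c i \<times> L_stat_ext_fib m (k - i) l (0, 0)"
  \<comment> \<open>As \<open>i \<le> k\<close>, the difference \<open>k - i\<close> is not
    truncated, and membership just says that the two counts add up to \<open>k\<close>.\<close>
  have B: "(R, S) \<in> ?B \<longleftrightarrow> R \<in> Tam c \<and> S \<in> L m \<and> ((0, 0), (1, m)) \<in> S
      \<and> card (stationary_cols c R) + card (stationary_cols m S) = k
      \<and> card (extendable_cols m S) = l" for R S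
  proof -
    have "S \<in> L m \<Longrightarrow> minimal_fibrant m S (0, 0) \<longleftrightarrow> ((0, 0), (1, m)) \<in> S"
      by (subst minimal_fibrant_iff) (auto simp: L_def)
    then show ?thesis by (auto simp: mem_Tam_stat mem_L_stat_ext_fib)
  qed
  have "bij_betw (\<lambda>(R, S). glue (Suc c) R S) ?B ?A"
  proof (rule bij_betw_imageI)
    show "inj_on (\<lambda>(R, S). glue (Suc c) R S) ?B"
    proof (rule inj_onI)
      fix p q assume p: "p \<in> ?B" and q: "q \<in> ?B"
        and eq: "(\<lambda>(R, S). glue (Suc c) R S) p = (\<lambda>(R, S). glue (Suc c) R S) q"
      obtain R S R' S' where pq: "p = (R, S)" "q = (R', S')" by (metis surj_pair)
      have RS: "R \<in> Tam c" "S \<in> L m" "((0, 0), (1, m)) \<in> S"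
        using p unfolding pq B by blast+
      have RS': "R' \<in> Tam c" "S' \<in> L m" "((0, 0), (1, m)) \<in> S'"
        using q unfolding pq B by blast+
      have "glue (Suc c) R S = glue (Suc c) R' S'" using eq by (simp add: pq)
      with slice_glue[OF RS] slice_glue[OF RS'] show "p = q" by (simp add: pq)
    qed
    show "(\<lambda>(R, S). glue (Suc c) R S) ` ?B = ?A"
    proof (intro equalityI subsetI)
      fix T assume "T \<in> (\<lambda>(R, S). glue (Suc c) R S) ` ?B"
      then obtain p where p: "p \<in> ?B" "T = (\<lambda>(R, S). glue (Suc c) R S) p" by (rule imageE)
      obtain R S where "p = (R, S)" by (cases p)
      with p have T: "T = glue (Suc c) R S" and "(R, S) \<in> ?B" by auto
      then have RS: "R \<in> Tam c" "S \<in> L m" "((0, 0), (1, m)) \<in> S"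
        and card: "card (stationary_cols c R) + card (stationary_cols m S) = k"
          "card (extendable_cols m S) = l"
        unfolding B by blast+
      show "T \<in> ?A"
        unfolding mem_L_stat_ext_fib T L_def
        using transfer_glue[OF RS] liftable_glue[OF RS] card_stationary_cols_glue[OF RS]
          card_extendable_cols_glue[OF RS] minimal_fibrant_glue[OF RS] card by simp
    next
      fix T assume T: "T \<in> ?A"
      then have ts: "transfer_system_on (grid (m + Suc c)) T" and TL: "T \<in> L (m + Suc c)"
        and min: "minimal_fibrant (m + Suc c) T (0, Suc c)"
        and card: "card (stationary_cols (m + Suc c) T) = k" "card (extendable_cols (m + Suc c) T) = l"
        by (auto simp: mem_L_stat_ext_fib L_def)
      note g = glue_slice[OF ts min]
      have SL: "slice (Suc c) m T \<in> L m" using slice_in_L[OF TL, of "Suc c" m] by simp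
      have "(slice 0 c T, slice (Suc c) m T) \<in> ?B"
        unfolding B
        using g SL card card_stationary_cols_glue[OF g(2) SL g(3)]
          card_extendable_cols_glue[OF g(2) SL g(3)] by simp
      then show "T \<in> (\<lambda>(R, S). glue (Suc c) R S) ` ?B"
        by (rule rev_image_eqI) (simp add: g(1))
    qed
  qed
  then have "card ?A = card ?B" by (simp add: bij_betw_same_card)
  \<comment> \<open>The pieces are disjoint because \<open>i\<close> is the number of stationary
    columns of the left component.\<close>
  also have "\<dots> = (\<Sum>i\<in>{0..k}. card (Tam_stat c i \<times> L_stat_ext_fib m (k - i) l (0, 0)))"
    by (rule card_UN_disjoint) (auto simp: mem_Tam_stat)
  finally show ?thesis by (simp add: card_cartesian_product)
qed

theorem theorem3p12:
  shows "(\<forall>n::nat. n \<ge> 1 \<longrightarrow>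
      (\<forall>k l::nat. 1 \<le> k \<and> k \<le> n + 1 \<and> 1 \<le> l \<and> l \<le> n + 1 \<longrightarrow>
         card (L_stat_ext_fib n k l (0, 0)) =
           (\<Sum>k' = k - 1..n. card (L_stat_ext (n - 1) k' (l - 1)))
       \<and> card (L_stat_ext_fib n k l (1, n)) =
           (\<Sum>l' = l - 1..n. card (L_stat_ext (n - 1) (k - 1) l'))
       \<and> (\<forall>b. 0 < b \<and> b \<le> n \<longrightarrow>
            card (L_stat_ext_fib n k l (0, b)) =
              (\<Sum>i = 0..k. card (Tam_stat (b - 1) i) *
                 card (L_stat_ext_fib (n - b) (k - i) l (0, 0))))
       \<and> (\<forall>b. 0 \<le> b \<and> b < n \<longrightarrow> card (L_stat_ext_fib n k l (1, b)) = 0)))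
    \<and> (\<forall>n::nat. card (L n) =
         (\<Sum>(k, l, x) \<in> {1..n + 1} \<times> {1..n + 1} \<times> grid n. card (L_stat_ext_fib n k l x)))"
proof (intro conjI allI impI; (elim conjE)?)
  fix n k l :: nat assume "1 \<le> n" and kl: "1 \<le> k" "1 \<le> l"
  then obtain m where n: "n = Suc m" by (cases n) auto
  show "card (L_stat_ext_fib n k l (0, 0)) = (\<Sum>k' = k - 1..n. card (L_stat_ext (n - 1) k' (l - 1)))"
    using card_fib_bottom[OF kl, of m] by (simp add: n)
  show "card (L_stat_ext_fib n k l (1, n)) = (\<Sum>l' = l - 1..n. card (L_stat_ext (n - 1) (k - 1) l'))"
    using card_fib_top[OF kl, of m] by (simp add: n)
next
  fix n k l b :: nat assume b: "0 < b" "b \<le> n"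
  \<comment> \<open>The left block has the columns \<open>0..b - 1\<close>, so
    \<open>c = b - 1\<close>, and the right block is a system for \<open>n - b\<close>.\<close>
  then obtain c where "b = Suc c" by (cases b) auto
  then show "card (L_stat_ext_fib n k l (0, b)) =
      (\<Sum>i = 0..k. card (Tam_stat (b - 1) i) * card (L_stat_ext_fib (n - b) (k - i) l (0, 0)))"
    using card_fib_lower_row[of "n - b" c k l] b by simp
qed (simp_all only: card_fib_upper_row card_L_eq_sum)

end
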